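(* Let $n\ge 1$ and $1\le k\le n$, and let $M_k$ be a matching of $k$ edges in the complete graph $K_{2n+1}$. Then $\chi'_L(K_{2n+1}\setminus M_k)=2n+1$ if $1\le k\le n-1$, and $\chi'_L(K_{2n+1}\setminus M_k)=2n$ if $k=n$.
   Context: $K_{2n+1}\setminus M_k$ denotes the graph obtained from $K_{2n+1}$ by deleting the edges of $M_k$. For a proper edge coloring $c:E(G)\to\{1,\dots,k\}$ of a connected graph $G$, let $\pi=(\mathcal{C}_1,\dots,\mathcal{C}_k)$ be the ordered partition of $E(G)$ into color classes. For a vertex $v$ and an edge $e=xy$, $d(v,e)=\min\{d(v,x),d(v,y)\}$, and $d(v,\mathcal{C}_i)=\min\{d(v,e): e\in\mathcal{C}_i\}$. The edge color code of $v$ is $c_\pi(v)=(d(v,\mathcal{C}_1),\dots,d(v,\mathcal{C}_k))$. The coloring is an edge-locating coloring if distinct vertices have distinct edge color codes; $\chi'_L(G)$ is the minimum number of colors in an edge-locating coloring of $G$. *)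

theory Defs
  imports Main "HOL-Library.Extended_Nat" "HOL-Library.Ramsey" "HOL-Library.Disjoint_Sets"
begin

text \<open>
  A finite simple graph is given by its vertex set \<open>V\<close> and its edge set \<open>E \<subseteq> nsets V 2\<close>.
  Distances are infima in \<^typ>\<open>enat\<close>, hence actual minima whenever the set in question is
  nonempty, and \<open>\<infinity>\<close> only if there is no walk (which cannot occur in a connected graph).
\<close>

definition walk :: "'a set \<Rightarrow> 'a set set \<Rightarrow> 'a list \<Rightarrow> bool" where
  "walk V E p \<longleftrightarrow> p \<noteq> [] \<and> set p \<subseteq> V \<and> successively (\<lambda>x y. {x, y} \<in> E) p"

definition vdist :: "'a set \<Rightarrow> 'a set set \<Rightarrow> 'a \<Rightarrow> 'a \<Rightarrow> enat" where
  "vdist V E u v = (INF p \<in> {p. walk V E p \<and> hd p = u \<and> last p = v}. enat (length p - 1))"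

definition edge_dist :: "'a set \<Rightarrow> 'a set set \<Rightarrow> 'a \<Rightarrow> 'a set \<Rightarrow> enat" where
  "edge_dist V E v e = (INF x\<in>e. vdist V E v x)"

definition class_dist :: "'a set \<Rightarrow> 'a set set \<Rightarrow> 'a \<Rightarrow> 'a set set \<Rightarrow> enat" where
  "class_dist V E v C = (INF e\<in>C. edge_dist V E v e)"

text \<open>
  The colour classes form a partition of the edge set into \<open>k\<close> (nonempty) parts, so each of the
  colours \<open>1, \<dots>, k\<close> is required to occur.
\<close>

definition proper_edge_coloring :: "'a set set \<Rightarrow> nat \<Rightarrow> ('a set \<Rightarrow> nat) \<Rightarrow> bool" where
  "proper_edge_coloring E k c \<longleftrightarrow>
     c ` E = {1..k} \<and> (\<forall>e\<in>E. \<forall>f\<in>E. e \<noteq> f \<and> e \<inter> f \<noteq> {} \<longrightarrow> c e \<noteq> c f)"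

definition color_class :: "'a set set \<Rightarrow> ('a set \<Rightarrow> nat) \<Rightarrow> nat \<Rightarrow> 'a set set" where
  "color_class E c i = {e \<in> E. c e = i}"

definition edge_color_code ::
  "'a set \<Rightarrow> 'a set set \<Rightarrow> nat \<Rightarrow> ('a set \<Rightarrow> nat) \<Rightarrow> 'a \<Rightarrow> enat list" where
  "edge_color_code V E k c v = map (\<lambda>i. class_dist V E v (color_class E c i)) [1..<Suc k]"

definition edge_locating_coloring ::
  "'a set \<Rightarrow> 'a set set \<Rightarrow> nat \<Rightarrow> ('a set \<Rightarrow> nat) \<Rightarrow> bool" where
  "edge_locating_coloring V E k c \<longleftrightarrow>
     proper_edge_coloring E k c \<and> inj_on (edge_color_code V E k c) V"

text \<open>
  Some graphs (e.g. a single edge) have no edge-locating coloring; the index is then \<open>\<infinity>\<close>.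
  Thus an index of \<open>enat m\<close> says that \<open>m\<close> is attained and is the minimum.
\<close>

definition edge_locating_chromatic_index :: "'a set \<Rightarrow> 'a set set \<Rightarrow> enat" where
  "edge_locating_chromatic_index V E =
     (INF k \<in> {k. \<exists>c. edge_locating_coloring V E k c}. enat k)"

definition matching :: "'a set set \<Rightarrow> 'a set set \<Rightarrow> bool" where
  "matching E M \<longleftrightarrow> M \<subseteq> E \<and> disjoint M"

end

theory Submission
  imports Defs "HOL-Number_Theory.Cong"
begin

text \<open>
  Label the vertices by the integers \<open>-n, \<dots>, n\<close> in such a way that the two ends of every edge of
  \<open>M\<close> carry opposite labels, and colour an edge by the sum of the labels of its ends modulo
  \<open>2n + 1\<close>. The vertex labelled \<open>x \<noteq> 0\<close> does not see the nonzero colour \<open>2x\<close>, but all other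
  vertices do, since the edges of \<open>M\<close> all have colour \<open>0\<close>; so the codes are distinct. The colour
  \<open>0\<close> survives the deletion of \<open>M\<close> iff \<open>k < n\<close>. Conversely, a colour class has at most \<open>n\<close>
  edges, so \<open>n (2n + 1) - k\<close> edges require \<open>2n + 1\<close> colours if \<open>k < n\<close> and \<open>2n\<close> colours if
  \<open>k = n\<close>.
\<close>

section \<open>Counting the edges of a colour class\<close>

lemma nsets_2_iff: "e \<in> nsets V 2 \<longleftrightarrow> (\<exists>x y. e = {x, y} \<and> x \<in> V \<and> y \<in> V \<and> x \<noteq> y)"
  by (auto simp: nsets_def card_2_iff)

lemma disjoint_pairs_card_le:
  assumes "finite V" "A \<subseteq> nsets V 2" "disjoint A"
  shows "2 * card A \<le> card V"
proof -
  have "card (\<Union>A) = sum card A"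
    using assms by (intro card_Union_disjoint) (auto simp: disjoint_def pairwise_def disjnt_def nsets_def)
  also have "\<dots> = 2 * card A"
    using assms by (auto simp: nsets_def subset_iff)
  finally have "2 * card A = card (\<Union>A)" by simp
  also have "\<dots> \<le> card V"
    using assms by (intro card_mono) (auto simp: nsets_def)
  finally show ?thesis .
qed

text \<open>Edges of one colour are pairwise disjoint, so \<open>2 * n + 1\<close> vertices leave
  room for at most \<open>n\<close> of them, and there are \<open>K\<close> classes. Both lower
  bounds on the index come from here.\<close>

lemma proper_edge_coloring_card_le:
  assumes "finite V" "card V = 2 * n + 1" "E \<subseteq> nsets V 2" "proper_edge_coloring E K c"
  shows "card E \<le> K * n"
proof -
  have finE: "finite E"
    using assms by (meson finite_imp_finite_nsets finite_subset)
  have class_le: "card (color_class E c i) \<le> n" for i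
  proof -
    have "disjoint (color_class E c i)"
      using assms(4) by (auto simp: disjoint_def color_class_def proper_edge_coloring_def)
    then have "2 * card (color_class E c i) \<le> card V"
      using assms by (intro disjoint_pairs_card_le) (auto simp: color_class_def)
    then show ?thesis using assms(2) by simp
  qed
  have "E = (\<Union>i\<in>{1..K}. color_class E c i)"
    using assms(4) by (auto simp: color_class_def proper_edge_coloring_def)
  then have "card E \<le> (\<Sum>i\<in>{1..K}. card (color_class E c i))"
    by (metis card_UN_le finite_atLeastAtMost)
  also have "\<dots> \<le> (\<Sum>i\<in>{1..K}. n)"
    by (intro sum_mono class_le)
  finally show ?thesis by simp
qed

section \<open>Distances and codes\<close>

lemma vdist_refl: "v \<in> V \<Longrightarrow> vdist V E v v = 0"
proof -
  assume "v \<in> V"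
  then have "vdist V E v v \<le> enat (length [v] - 1)"
    unfolding vdist_def by (intro INF_lower) (auto simp: walk_def)
  then show ?thesis by (simp flip: zero_enat_def)
qed

lemma vdist_ge_1:
  assumes "u \<noteq> v"
  shows "1 \<le> vdist V E u v"
  unfolding vdist_def
proof (rule INF_greatest)
  fix p assume "p \<in> {p. walk V E p \<and> hd p = u \<and> last p = v}"
  with assms show "1 \<le> enat (length p - 1)"
    by (cases p) (auto simp: walk_def one_enat_def Suc_le_eq split: if_splits)
qed

text \<open>Distinct vertices are at distance at least 1, so distance 0 can only come from an edge
  through \<open>v\<close>. Hence zero entries of a code record exactly the colours seen at the
  vertex, and no other distance has to be computed.\<close>

lemma class_dist_eq_0_iff:
  assumes "v \<in> V"
  shows "class_dist V E v C = 0 \<longleftrightarrow> v \<in> \<Union>C"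
proof
  assume "v \<in> \<Union>C"
  then obtain e where e: "e \<in> C" "v \<in> e" by blast
  have "class_dist V E v C \<le> edge_dist V E v e"
    unfolding class_dist_def using e by (intro INF_lower)
  also have "\<dots> \<le> vdist V E v v"
    unfolding edge_dist_def using e by (intro INF_lower)
  finally show "class_dist V E v C = 0"
    using assms by (simp add: vdist_refl)
next
  assume 0: "class_dist V E v C = 0"
  show "v \<in> \<Union>C"
  proof (rule ccontr)
    assume "v \<notin> \<Union>C"
    then have "1 \<le> class_dist V E v C"
      unfolding class_dist_def edge_dist_def by (intro INF_greatest vdist_ge_1) auto
    with 0 show False by simp
  qed
qed

text \<open>A colour seen at only one of two vertices gives code entries of which exactly one is
  0.\<close>

lemma edge_locating_coloringI:
  assumes "proper_edge_coloring E K c"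
    and "\<And>x y. x \<in> V \<Longrightarrow> y \<in> V \<Longrightarrow> x \<noteq> y \<Longrightarrow>
           \<exists>i\<in>{1..K}. (x \<in> \<Union>(color_class E c i)) \<noteq> (y \<in> \<Union>(color_class E c i))"
  shows "edge_locating_coloring V E K c"
  unfolding edge_locating_coloring_def
proof (intro conjI inj_onI)
  fix x y assume xy: "x \<in> V" "y \<in> V" "edge_color_code V E K c x = edge_color_code V E K c y"
  then have "class_dist V E x (color_class E c i) = class_dist V E y (color_class E c i)"
    if "i \<in> {1..K}" for i
    using that xy(3) unfolding edge_color_code_def map_eq_conv
    by (metis atLeastAtMost_iff atLeastLessThan_iff le_imp_less_Suc set_upt)
  then show "x = y"
    using assms(2)[OF xy(1,2)] class_dist_eq_0_iff[OF xy(1)] class_dist_eq_0_iff[OF xy(2)]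
    by metis
qed (fact assms(1))

section \<open>Antipodal labellings\<close>

text \<open>Induction on \<open>n\<close>: remove two vertices, the ends of an edge of
  \<open>M\<close> if there is one and arbitrary otherwise, label the rest, and give the removed
  vertices the two new extreme labels. Disjointness of \<open>M\<close> keeps all its other edges
  among the remaining vertices.\<close>

lemma ex_antipodal_labelling:
  assumes "finite V" "card V = 2 * n + 1" "M \<subseteq> nsets V 2" "disjoint M"
  shows "\<exists>l. bij_betw l V {- int n..int n} \<and> (\<forall>e\<in>M. sum l e = 0)"
  using assms
proof (induction n arbitrary: V M)
  case 0
  then obtain v where v: "V = {v}" by (auto simp: card_1_singleton_iff)
  then have "M = {}"
    using 0 nsets_2_iff[of _ V] by auto
  then show ?case using v by (auto simp: bij_betw_def intro!: exI[of _ "\<lambda>_. 0"])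
next
  case (Suc n)
  obtain a b where ab: "a \<in> V" "b \<in> V" "a \<noteq> b" and M: "M \<subseteq> insert {a, b} (nsets (V - {a, b}) 2)"
  proof (cases "M = {}")
    case True
    have "2 \<le> card V" using Suc.prems by simp
    then obtain T where "T \<subseteq> V" "card T = 2" by (meson obtain_subset_with_card_n)
    with True that show thesis by (auto simp: card_2_iff)
  next
    case False
    then obtain a b where ab: "{a, b} \<in> M" "a \<in> V" "b \<in> V" "a \<noteq> b"
      using Suc.prems(3) by (metis all_not_in_conv nsets_2_iff subsetD)
    have "e \<in> insert {a, b} (nsets (V - {a, b}) 2)" if "e \<in> M" for e
    proof (cases "e = {a, b}")
      case False
      then have "e \<inter> {a, b} = {}"
        using Suc.prems(4) ab that by (metis disjointD)
      then show ?thesis using Suc.prems(3) that by (auto simp: nsets_def)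
    qed simp
    with ab that show thesis by blast
  qed
  define V' where "V' = V - {a, b}"
  define M' where "M' = M - {{a, b}}"
  have "card V' = 2 * n + 1"
    using Suc.prems(1,2) ab by (simp add: V'_def card_Diff_subset)
  moreover have M': "M' \<subseteq> nsets V' 2" using M by (auto simp: V'_def M'_def)
  moreover have "disjoint M'" using Suc.prems(4) by (auto simp: M'_def disjoint_def)
  ultimately obtain l where l: "bij_betw l V' {- int n..int n}" "\<forall>e\<in>M'. sum l e = 0"
    using Suc.IH[of V' M'] Suc.prems(1) by (auto simp: V'_def)
  define l' where "l' = l(a := int n + 1, b := - int n - 1)"
  have eq: "l' x = l x" if "x \<in> V'" for x
    using that by (auto simp: l'_def V'_def)
  have "bij_betw l' V' {- int n..int n}"
    using l(1) eq by (simp cong: bij_betw_cong)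
  moreover have "bij_betw l' {a, b} {int n + 1, - int n - 1}"
    using ab by (auto simp: l'_def bij_betw_def)
  ultimately have "bij_betw l' (V' \<union> {a, b}) ({- int n..int n} \<union> {int n + 1, - int n - 1})"
    by (intro bij_betw_combine) auto
  moreover have "V' \<union> {a, b} = V" using ab by (auto simp: V'_def)
  moreover have "{- int n..int n} \<union> {int n + 1, - int n - 1} = {- int (Suc n)..int (Suc n)}"
    by auto
  moreover have "sum l' e = 0" if "e \<in> M" for e
  proof (cases "e = {a, b}")
    case True
    then show ?thesis using ab by (simp add: l'_def)
  next
    case False
    with that have "e \<in> M'" by (simp add: M'_def)
    moreover from this M' have "e \<subseteq> V'" by (auto simp: nsets_def)
    then have "sum l' e = sum l e" using eq by (intro sum.cong) auto
    ultimately show ?thesis using l(2) by simp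
  qed
  ultimately show ?case by auto
qed

text \<open>The pairs are indexed by their positive label \<open>i\<close> in
  \<open>{1..int n}\<close>. The count later decides whether deleting \<open>M\<close> removes every
  edge of label sum 0.\<close>

lemma card_antipodal_pairs:
  assumes "bij_betw l V {- int n..int n}"
  shows "card {e \<in> nsets V 2. sum l e = 0} = n"
proof -
  define g where "g = inv_into V l"
  have gV: "g i \<in> V" and lg: "l (g i) = i" if "i \<in> {- int n..int n}" for i
    using assms that by (auto simp: g_def bij_betw_def inv_into_into f_inv_into_f)
  have gl: "g (l x) = x" "l x \<in> {- int n..int n}" if "x \<in> V" for x
    using assms that by (auto simp: g_def bij_betw_def)
  have "inj_on (\<lambda>i. {g i, g (- i)}) {1..int n}"
  proof (rule inj_onI)
    fix i j assume ij: "i \<in> {1..int n}" "j \<in> {1..int n}" "{g i, g (- i)} = {g j, g (- j)}"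
    then have "l ` {g i, g (- i)} = l ` {g j, g (- j)}" by simp
    then have "{i, - i} = {j, - j}" using ij(1,2) by (simp add: lg)
    then show "i = j" using ij(1,2) by (auto simp: doubleton_eq_iff)
  qed
  moreover have "(\<lambda>i. {g i, g (- i)}) ` {1..int n} = {e \<in> nsets V 2. sum l e = 0}"
  proof (intro equalityI subsetI)
    fix e assume "e \<in> (\<lambda>i. {g i, g (- i)}) ` {1..int n}"
    then obtain i where i: "e = {g i, g (- i)}" "i \<in> {1..int n}" by blast
    then have "g i \<noteq> g (- i)" using lg[of i] lg[of "- i"] by auto
    with i show "e \<in> {e \<in> nsets V 2. sum l e = 0}"
      by (auto simp: nsets_2_iff lg intro!: exI gV)
  next
    fix e assume "e \<in> {e \<in> nsets V 2. sum l e = 0}"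
    then obtain x y where e: "e = {x, y}" "x \<in> V" "y \<in> V" "x \<noteq> y" "l x + l y = 0"
      by (auto simp: nsets_2_iff)
    \<comment> \<open>Both descriptions are kept because either end may be the one with the positive
      label.\<close>
    have eq: "e = {g (l x), g (- l x)}" "e = {g (l y), g (- l y)}"
    proof -
      have "- l x = l y" "- l y = l x" using e(5) by linarith+
      then have "g (- l x) = y" "g (- l y) = x" using e(2,3) gl(1) by metis+
      then show "e = {g (l x), g (- l x)}" "e = {g (l y), g (- l y)}"
        using e(1-3) gl(1) by auto
    qed
    have "l x \<noteq> l y" using e gl by metis
    then have "l x \<in> {1..int n} \<or> l y \<in> {1..int n}"
      using gl(2)[OF e(2)] gl(2)[OF e(3)] e(5) by auto
    then show "e \<in> (\<lambda>i. {g i, g (- i)}) ` {1..int n}"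
      using eq by blast
  qed
  ultimately show ?thesis
    using card_image[of "\<lambda>i. {g i, g (- i)}" "{1..int n}"] by simp
qed

section \<open>Sums of labels modulo 2n + 1 as colours\<close>

text \<open>The residue \<open>0\<close> is represented by the colour \<open>m\<close>, as colours start at \<open>1\<close>.\<close>

definition sum_color :: "('a \<Rightarrow> int) \<Rightarrow> nat \<Rightarrow> 'a set \<Rightarrow> nat" where
  "sum_color l m e = (if int m dvd sum l e then m else nat (sum l e mod int m))"

lemma sum_color_eq_iff:
  assumes "m > 0"
  shows "sum_color l m e = sum_color l m f \<longleftrightarrow> [sum l e = sum l f] (mod int m)"
proof -
  define r s where "r = sum l e mod int m" and "s = sum l f mod int m"
  have "r < int m" "r \<ge> 0" "s < int m" "s \<ge> 0" using assms by (auto simp: r_def s_def)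
  then have "(if r = 0 then m else nat r) = (if s = 0 then m else nat s) \<longleftrightarrow> r = s"
    by (auto simp: eq_nat_nat_iff)
  then show ?thesis
    by (simp only: sum_color_def cong_def dvd_eq_mod_eq_0 r_def s_def)
qed

lemma sum_color_bounds:
  assumes "m > 0"
  shows "1 \<le> sum_color l m e" "sum_color l m e \<le> m"
    "sum_color l m e = m \<longleftrightarrow> int m dvd sum l e"
proof -
  define r where "r = sum l e mod int m"
  have "r < int m" "r \<ge> 0" using assms by (auto simp: r_def)
  moreover have "sum_color l m e = (if r = 0 then m else nat r)" "int m dvd sum l e \<longleftrightarrow> r = 0"
    by (auto simp: sum_color_def r_def dvd_eq_mod_eq_0)
  ultimately show "1 \<le> sum_color l m e" "sum_color l m e \<le> m"
    "sum_color l m e = m \<longleftrightarrow> int m dvd sum l e"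
    using assms by auto
qed

text \<open>Two such integers differ by at most \<open>2 * n\<close>, which is less than the
  modulus.\<close>

lemma cong_symmetric_residues_eq:
  fixes x y :: int
  assumes "[x = y] (mod int (2 * n + 1))" "x \<in> {- int n..int n}" "y \<in> {- int n..int n}"
  shows "x = y"
proof (rule ccontr)
  assume "x \<noteq> y"
  moreover have "int (2 * n + 1) dvd x - y" using assms(1) by (simp add: cong_iff_dvd_diff)
  ultimately have "int (2 * n + 1) \<le> \<bar>x - y\<bar>" 
    using dvd_imp_le_int[of "x - y" "int (2 * n + 1)"] by simp
  then show False using assms(2,3) by auto
qed

lemma ex_symmetric_residue:
  "\<exists>u\<in>{- int n..int n}. [u = t] (mod int (2 * n + 1))"
proof
  let ?u = "(t + int n) mod int (2 * n + 1) - int n"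
  have "0 \<le> (t + int n) mod int (2 * n + 1)" "(t + int n) mod int (2 * n + 1) < int (2 * n + 1)"
    by (rule pos_mod_sign pos_mod_bound; simp)+
  then show "?u \<in> {- int n..int n}" unfolding atLeastAtMost_iff by linarith
  have "[(t + int n) mod int (2 * n + 1) - int n = (t + int n) - int n] (mod int (2 * n + 1))"
    by (intro cong_diff) (auto simp: cong_def)
  then show "[?u = t] (mod int (2 * n + 1))" by simp
qed

section \<open>The sum colouring is edge-locating\<close>

lemma edge_locating_sum_color:
  fixes l :: "'a \<Rightarrow> int"
  assumes bij: "bij_betw l V {- int n..int n}" and M0: "\<forall>e\<in>M. sum l e = 0"
    and K: "K = (if {e \<in> nsets V 2. sum l e = 0} \<subseteq> M then 2 * n else 2 * n + 1)"
  shows "edge_locating_coloring V (nsets V 2 - M) K (sum_color l (2 * n + 1))"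
proof (rule edge_locating_coloringI)
  define m where "m = 2 * n + 1"
  define E where "E = nsets V 2 - M"
  have m: "m > 0" by (simp add: m_def)
  have range: "l x \<in> {- int n..int n}" if "x \<in> V" for x
    using bij that by (auto simp: bij_betw_def)
  have l_cong: "x = y" if "x \<in> V" "y \<in> V" "[l x = l y] (mod int m)" for x y
  proof -
    have "l x = l y" using cong_symmetric_residues_eq that range unfolding m_def by blast
    then show ?thesis using bij that by (auto simp: bij_betw_def inj_on_def)
  qed
  have ex_vertex: "\<exists>z\<in>V. [l z = t] (mod int m)" for t
    using ex_symmetric_residue[of n t] bij unfolding m_def bij_betw_def by (metis imageE)
  \<comment> \<open>The label range is symmetric, so \<open>- l y\<close> is again a label and
    congruence forces equality. Thus the edges of colour \<open>m\<close> are exactly the remaining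
    edges of label sum 0.\<close>
  have sum_0: "l x + l y = 0" if "x \<in> V" "y \<in> V" "int m dvd l x + l y" for x y
  proof -
    have "[l x = - l y] (mod int m)" using that(3) by (simp add: cong_iff_dvd_diff)
    moreover have "- l y \<in> {- int n..int n}" using range[OF that(2)] by auto
    ultimately show ?thesis
      using cong_symmetric_residues_eq[of "l x" "- l y" n] range[OF that(1)] by (simp add: m_def)
  qed
  \<comment> \<open>The modulus is odd, so doubling is injective on residues.\<close>
  have double: "x = y" if "x \<in> V" "y \<in> V" "[2 * l x = 2 * l y] (mod int m)" for x y
  proof -
    have "coprime 2 (int m)" by (simp add: m_def)
    then have "[l x = l y] (mod int m)" using that(3) by (simp add: cong_mult_lcancel)
    then show ?thesis using l_cong that by blast
  qed
  \<comment> \<open>The other end must carry the label \<open>t - l y\<close> modulo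
    \<open>m\<close>. The first condition on \<open>t\<close> makes it differ from \<open>y\<close>;
    the second keeps the edge out of \<open>M\<close>, whose edges have sum 0.\<close>
  have edge: "\<exists>e\<in>E. y \<in> e \<and> [sum l e = t] (mod int m)"
    if y: "y \<in> V" "\<not> [t = 2 * l y] (mod int m)" and t: "\<not> int m dvd t" for y t
  proof -
    obtain z where z: "z \<in> V" "[l z = t - l y] (mod int m)" using ex_vertex by blast
    then have s: "[l y + l z = t] (mod int m)"
      by (simp add: cong_iff_dvd_diff algebra_simps)
    then have "y \<noteq> z" using y(2) cong_sym[OF s] by (metis mult_2)
    then have sum: "sum l {y, z} = l y + l z" by simp
    then have "sum l {y, z} \<noteq> 0" using s t by (auto simp: cong_def)
    then have "{y, z} \<in> E" using M0 y z \<open>y \<noteq> z\<close> by (auto simp: E_def nsets_2_iff)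
    with s sum show ?thesis by (metis insertI1)
  qed
  have "sum_color l m ` E = {1..K}"
  proof (intro equalityI subsetI)
    fix i assume "i \<in> sum_color l m ` E"
    then obtain e where e: "e \<in> E" "i = sum_color l m e" by blast
    then obtain x y where xy: "e = {x, y}" "x \<in> V" "y \<in> V" "x \<noteq> y"
      by (auto simp: E_def nsets_2_iff)
    have "i \<noteq> m" if "{e \<in> nsets V 2. sum l e = 0} \<subseteq> M"
    proof
      assume "i = m"
      then have "sum l e = 0" using e xy m sum_0 by (auto simp: sum_color_bounds(3))
      with that e(1) show False by (auto simp: E_def)
    qed
    with sum_color_bounds[OF m, of l e] e(2) show "i \<in> {1..K}"
      by (auto simp: K m_def)
  next
    fix i assume i: "i \<in> {1..K}"
    show "i \<in> sum_color l m ` E"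
    proof (cases "i = m")
      case True
      then obtain e where "e \<in> E" "sum l e = 0"
        using i by (auto simp: K m_def E_def split: if_splits)
      then show ?thesis using True by (auto simp: sum_color_def intro!: image_eqI[of _ _ e])
    next
      case False
      then have im: "0 < i" "i < m" using i by (auto simp: K m_def split: if_splits)
      then have ndvd: "\<not> int m dvd int i" by (auto dest: dvd_imp_le)
      \<comment> \<open>The vertex labelled 0 sees all nonzero residues, so it witnesses every
        colour below \<open>m\<close>.\<close>
      obtain y where y: "y \<in> V" "[l y = 0] (mod int m)" using ex_vertex by blast
      have "[2 * l y = 0] (mod int m)" using y(2) by (simp add: cong_0_iff)
      then have "\<not> [int i = 2 * l y] (mod int m)"
        using ndvd by (meson cong_0_iff cong_trans)
      then obtain e where e: "e \<in> E" "[sum l e = int i] (mod int m)"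
        using edge y(1) ndvd by blast
      then have "sum_color l m e = i"
        using im ndvd by (auto simp: sum_color_def cong_def dvd_eq_mod_eq_0)
      with e(1) show ?thesis by blast
    qed
  qed
  moreover have "sum_color l m e \<noteq> sum_color l m f"
    if ef: "e \<in> E" "f \<in> E" "e \<noteq> f" "e \<inter> f \<noteq> {}" for e f
  proof
    assume "sum_color l m e = sum_color l m f"
    then have s: "[sum l e = sum l f] (mod int m)" using m by (simp add: sum_color_eq_iff)
    obtain x where "x \<in> e" "x \<in> f" using ef(4) by blast
    then obtain y z where yz: "e = {x, y}" "f = {x, z}" "x \<noteq> y" "x \<noteq> z" "y \<in> V" "z \<in> V"
      using ef(1,2) by (auto simp: E_def nsets_2_iff insert_commute)
    then have "[l y = l z] (mod int m)" using s by (simp add: cong_add_lcancel)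
    then have "y = z" using l_cong yz by blast
    with yz ef(3) show False by simp
  qed
  ultimately show "proper_edge_coloring (nsets V 2 - M) K (sum_color l (2 * n + 1))"
    unfolding E_def m_def by (auto simp: proper_edge_coloring_def)

  \<comment> \<open>The separating colour is that of the residue \<open>2 * l x\<close>. It is
    nonzero because \<open>l x\<close> is, so \<open>edge\<close> provides it at
    \<open>y\<close>.\<close>
  have separate: "\<exists>i\<in>{1..K}. x \<notin> \<Union>(color_class E (sum_color l m) i) \<and>
                   y \<in> \<Union>(color_class E (sum_color l m) i)"
    if xy: "x \<in> V" "y \<in> V" "x \<noteq> y" "l x \<noteq> 0" for x y
  proof -
    have ndvd: "\<not> int m dvd 2 * l x" using sum_0[of x x] xy by auto
    have "\<not> [2 * l x = 2 * l y] (mod int m)" using double xy by blast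
    then obtain e where e: "e \<in> E" "y \<in> e" "[sum l e = 2 * l x] (mod int m)"
      using edge xy ndvd by blast
    let ?i = "sum_color l m e"
    have "\<not> int m dvd sum l e" using e(3) ndvd by (simp add: cong_def dvd_eq_mod_eq_0)
    then have "?i \<in> {1..K}"
      using sum_color_bounds[OF m, of l e] by (auto simp: K m_def)
    moreover have "x \<notin> \<Union>(color_class E (sum_color l m) ?i)"
    proof
      assume "x \<in> \<Union>(color_class E (sum_color l m) ?i)"
      then obtain f where f: "f \<in> E" "x \<in> f" "sum_color l m f = ?i"
        by (auto simp: color_class_def)
      then obtain z where z: "f = {x, z}" "z \<in> V" "x \<noteq> z"
        by (auto simp: E_def nsets_2_iff insert_commute)
      \<comment> \<open>An edge at \<open>x\<close> of this colour would have a second end labelled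
        like \<open>x\<close>, hence equal to \<open>x\<close>.\<close>
      have "[l x + l z = l x + l x] (mod int m)"
        using f(3) z e(3) m by (auto simp: sum_color_eq_iff intro: cong_trans)
      then have "[l z = l x] (mod int m)" by (simp only: cong_add_lcancel)
      then show False using l_cong z xy(1) by blast
    qed
    ultimately show ?thesis using e by (auto simp: color_class_def)
  qed
  fix x y assume xy: "x \<in> V" "y \<in> V" "x \<noteq> y"
  \<comment> \<open>Only one vertex is labelled 0, so at least one of the two can supply the
    separating colour.\<close>
  then have "l x \<noteq> 0 \<or> l y \<noteq> 0" using l_cong by (metis cong_refl)
  then show "\<exists>i\<in>{1..K}. (x \<in> \<Union>(color_class (nsets V 2 - M) (sum_color l (2 * n + 1)) i)) \<noteq>
               (y \<in> \<Union>(color_class (nsets V 2 - M) (sum_color l (2 * n + 1)) i))"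
    using separate[of x y] separate[of y x] xy unfolding E_def m_def by blast
qed

section \<open>The value of the index\<close>

lemma edge_locating_chromatic_indexI:
  assumes "edge_locating_coloring V E K c"
    and "\<And>K' c'. edge_locating_coloring V E K' c' \<Longrightarrow> K \<le> K'"
  shows "edge_locating_chromatic_index V E = enat K"
  unfolding edge_locating_chromatic_index_def
proof (rule antisym)
  show "(INF k\<in>{k. \<exists>c. edge_locating_coloring V E k c}. enat k) \<le> enat K"
    using assms(1) by (intro INF_lower) blast
  show "enat K \<le> (INF k\<in>{k. \<exists>c. edge_locating_coloring V E k c}. enat k)"
    using assms(2) by (intro INF_greatest) auto
qed

theorem theorem10:
  fixes V :: "'a set" and M :: "'a set set" and n k :: nat
  assumes "n \<ge> 1" and "1 \<le> k" and "k \<le> n"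
    and "finite V" and "card V = 2 * n + 1"
    and "matching (nsets V 2) M" and "finite M" and "card M = k"
  shows "(k \<le> n - 1 \<longrightarrow>
            edge_locating_chromatic_index V (nsets V 2 - M) = enat (2 * n + 1)) \<and>
         (k = n \<longrightarrow>
            edge_locating_chromatic_index V (nsets V 2 - M) = enat (2 * n))"
proof -
  have M: "M \<subseteq> nsets V 2" "disjoint M" using assms(6) by (auto simp: matching_def)
  obtain l where l: "bij_betw l V {- int n..int n}" "\<forall>e\<in>M. sum l e = 0"
    using ex_antipodal_labelling[OF assms(4,5) M] by blast
  define Z where "Z = {e \<in> nsets V 2. sum l e = 0}"
  have Z: "card Z = n" "M \<subseteq> Z" "finite Z"
    using card_antipodal_pairs[OF l(1)] l(2) M(1) finite_imp_finite_nsets[OF assms(4)]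
    by (auto simp: Z_def)
  \<comment> \<open>Since \<open>M\<close> lies in \<open>Z\<close> and \<open>Z\<close> has
    \<open>n\<close> elements, equality of the two sets is a matter of cardinality.\<close>
  have Z_sub: "Z \<subseteq> M \<longleftrightarrow> k = n"
    using Z assms(7,8) by (metis card_subset_eq subset_antisym subset_refl)
  define K where "K = (if k = n then 2 * n else 2 * n + 1)"
  have "card (nsets V 2 - M) = card (nsets V 2) - k"
    using M(1) assms(7,8) by (simp add: card_Diff_subset)
  also have "card (nsets V 2) = (2 * n + 1) * n"
    by (simp add: card_nsets assms(5) choose_two)
  \<comment> \<open>The additive form avoids truncated subtraction; it is valid as \<open>k\<close>
    is at most \<open>n\<close>, hence at most the total number of edges.\<close>
  finally have card_E: "card (nsets V 2 - M) + k = (2 * n + 1) * n"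
    using assms(1,3) by simp
  have "edge_locating_chromatic_index V (nsets V 2 - M) = enat K"
  proof (rule edge_locating_chromatic_indexI)
    show "edge_locating_coloring V (nsets V 2 - M) K (sum_color l (2 * n + 1))"
      using Z_sub by (intro edge_locating_sum_color l) (simp add: K_def Z_def)
  next
    fix K' c' assume "edge_locating_coloring V (nsets V 2 - M) K' c'"
    then have "card (nsets V 2 - M) \<le> K' * n"
      using assms(4,5) by (intro proper_edge_coloring_card_le) (auto simp: edge_locating_coloring_def)
    then have le: "(2 * n + 1) * n \<le> K' * n + k" using card_E by simp
    show "K \<le> K'"
    proof (cases "k = n")
      case True
      then have "2 * n * n \<le> K' * n" using le by (simp add: algebra_simps)
      then show ?thesis using True assms(1) by (simp add: K_def)
    next
      case False
      \<comment> \<open>With only \<open>2 * n\<close> colours, at most \<open>2 * n * n\<close>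
        edges can be coloured, but \<open>2 * n * n + n - k\<close> remain and
        \<open>k < n\<close>.\<close>
      have "2 * n < K'"
      proof (rule ccontr)
        assume "\<not> 2 * n < K'"
        then have "K' * n \<le> 2 * n * n" by (intro mult_right_mono) auto
        moreover have "(2 * n + 1) * n = 2 * n * n + n" by simp
        ultimately show False using le False assms(3) by linarith
      qed
      then show ?thesis using False by (simp add: K_def)
    qed
  qed
  then show ?thesis using assms(1) by (auto simp: K_def)
qed

end
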